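(* Let $p,q,c\in\mathbb{R}$. Then $\mathcal{W}_{p,q,c}\subset\mathcal{U}_{p,q,c}$, where $\mathcal{U}_{p,q,c}=\big((\mathcal{K}_{p,q,c})^\Lambda\big)^\circ$ is the interior of the $\Lambda$-convex hull of the constitutive set $\mathcal{K}_{p,q,c}$ of the hydrostatic Euler equations, and $\mathcal{W}_{p,q,c}$ is the explicit set defined in the context.
   Context: $\mathrm{Sym}_0(2)$ is the space of symmetric trace-free real $2\times2$ matrices, $\mathbb{I}_2$ the identity matrix, $\lambda_{\max}$ the largest eigenvalue of a symmetric matrix, $S^\circ$ the interior of $S$, and $[\cdot]_i$, $[\cdot]_{ij}$ denote components. Constitutive set: $$\mathcal{K}_{p,q,c}=\{(u,w,U,W)\in\mathbb{R}^2\times\mathbb{R}\times\mathrm{Sym}_0(2)\times\mathbb{R}^2\mid u\otimes u-U+(p-q)\mathbb{I}_2=0,\ W=uw,\ |w|=c\}.$$ Wave cone: $\Lambda$ is the set of $(u,w,U,W)\in\mathbb{R}^2\times\mathbb{R}\times\mathrm{Sym}_0(2)\times\mathbb{R}^2$ for which there is $\eta=(\eta_t,\eta_x)\in\mathbb{R}\times\mathbb{R}^3$ with $\eta_x\ne0$ and $$\begin{pmatrix} 0 & u^\top & w \\ u & U & W \end{pmatrix}\eta=0.$$ A set $S$ is $\Lambda$-convex if the closed segment $[x,y]\subset S$ for all $x,y\in S$ with $x-y\in\Lambda$; the $\Lambda$-convex hull $\mathcal{K}^\Lambda$ is the smallest $\Lambda$-convex set containing $\mathcal{K}$. For $(u,U)\in\mathbb{R}^2\times\mathrm{Sym}_0(2)$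 with $\lambda_{\max}(u\otimes u-U-(q-p)\mathbb{I}_2)<0$ put $$f^{1,\pm}_{p,q}(u,U)=\frac{[u]_2[U]_{12}\pm\sqrt{(q-p-[U]_{11}-[u]_2^2)\det((q-p)\mathbb{I}_2+U)}}{q-p-[U]_{11}},$$ $$f^{2,\pm}_{p,q}(u,U)=\frac{[u]_1[U]_{12}\pm\sqrt{(q-p+[U]_{11}-[u]_1^2)\det((q-p)\mathbb{I}_2+U)}}{q-p+[U]_{11}}$$ (these are well defined real numbers under the stated condition). $\mathcal{W}_{p,q,c}$ is the set of all $(u,w,U,W)\in\mathbb{R}^2\times\mathbb{R}\times\mathrm{Sym}_0(2)\times\mathbb{R}^2$ such that $\lambda_{\max}(u\otimes u-U-(q-p)\mathbb{I}_2)<0$, $|w|<c$, and there exists $\tau\in(0,1)$ with (writing $f^{j,\pm}=f^{j,\pm}_{p,q}(u,U)$) $$[W]_1<[u]_1w+\tau\min\{([u]_1-f^{1,-})(c-w),\ (f^{1,+}-[u]_1)(w+c)\},$$ $$[W]_1>[u]_1w-\tau\min\{([u]_1-f^{1,-})(w+c),\ (f^{1,+}-[u]_1)(c-w)\},$$ $$[W]_2<[u]_2w+(1-\tau)\min\{([u]_2-f^{2,-})(c-w),\ (f^{2,+}-[u]_2)(w+c)\},$$ $$[W]_2>[u]_2w-(1-\tau)\min\{([u]_2-f^{2,-})(w+c),\ (f^{2,+}-[u]_2)(c-w)\}.$$ *)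

theory Defs
  imports "HOL-Analysis.Analysis"
begin

definition Sym0 :: "(real^2^2) set" where
  "Sym0 = {U. transpose U = U \<and> trace U = 0}"

type_synonym state = "(real^2) \<times> real \<times> (real^2^2) \<times> (real^2)"

(* The ambient type is larger than the space of states (U is an arbitrary 2x2 matrix there),
   so the convexity and interior notions below are taken relative to this linear subspace. *)
definition state_space :: "state set" where
  "state_space = UNIV \<times> UNIV \<times> Sym0 \<times> UNIV"

definition outer :: "real^2 \<Rightarrow> real^2 \<Rightarrow> real^2^2" where
  "outer u v = (\<chi> i j. u $ i * v $ j)"

definition eigenvalues :: "real^'n^'n \<Rightarrow> real set" where
  "eigenvalues A = {l. \<exists>v. v \<noteq> 0 \<and> A *v v = l *\<^sub>R v}"

(* Only meaningful for symmetric A, where the set of real eigenvalues is finite and nonempty. *)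
definition lambda_max :: "real^'n^'n \<Rightarrow> real" where
  "lambda_max A = Max (eigenvalues A)"

definition constitutive_set :: "real \<Rightarrow> real \<Rightarrow> real \<Rightarrow> state set" where
  "constitutive_set p q c =
     {(u, w, U, W). U \<in> Sym0 \<and> outer u u - U + (p - q) *\<^sub>R mat 1 = 0 \<and> W = w *\<^sub>R u \<and> \<bar>w\<bar> = c}"

definition wave_matrix :: "state \<Rightarrow> real^4^3" where
  "wave_matrix = (\<lambda>(u, w, U, W). vector
     [vector [0,     u $ 1,     u $ 2,     w],
      vector [u $ 1, U $ 1 $ 1, U $ 1 $ 2, W $ 1],
      vector [u $ 2, U $ 2 $ 1, U $ 2 $ 2, W $ 2]])"

definition wave_cone :: "state set" where
  "wave_cone = {z \<in> state_space. \<exists>(\<eta>t :: real) (\<eta>x :: real^3). \<eta>x \<noteq> 0 \<and>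
     wave_matrix z *v vector [\<eta>t, \<eta>x $ 1, \<eta>x $ 2, \<eta>x $ 3] = 0}"

definition wave_cone_convex :: "state set \<Rightarrow> bool" where
  "wave_cone_convex S \<longleftrightarrow> S \<subseteq> state_space \<and>
     (\<forall>x\<in>S. \<forall>y\<in>S. x - y \<in> wave_cone \<longrightarrow> closed_segment x y \<subseteq> S)"

definition U_set :: "real \<Rightarrow> real \<Rightarrow> real \<Rightarrow> state set" where
  "U_set p q c =
     (top_of_set state_space) interior_of (wave_cone_convex hull (constitutive_set p q c))"

(* s = 1 and s = -1 give the functions with superscript + and -, respectively.
   They are used only where the denominator is positive and the radicand nonnegative. *)
definition f1 :: "real \<Rightarrow> real \<Rightarrow> real \<Rightarrow> real^2 \<Rightarrow> real^2^2 \<Rightarrow> real" where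
  "f1 s p q u U =
     (u $ 2 * U $ 1 $ 2
        + s * sqrt ((q - p - U $ 1 $ 1 - (u $ 2)\<^sup>2) * det ((q - p) *\<^sub>R mat 1 + U)))
     / (q - p - U $ 1 $ 1)"

definition f2 :: "real \<Rightarrow> real \<Rightarrow> real \<Rightarrow> real^2 \<Rightarrow> real^2^2 \<Rightarrow> real" where
  "f2 s p q u U =
     (u $ 1 * U $ 1 $ 2
        + s * sqrt ((q - p + U $ 1 $ 1 - (u $ 1)\<^sup>2) * det ((q - p) *\<^sub>R mat 1 + U)))
     / (q - p + U $ 1 $ 1)"

definition W_set :: "real \<Rightarrow> real \<Rightarrow> real \<Rightarrow> state set" where
  "W_set p q c = {(u, w, U, W). U \<in> Sym0 \<and>
     lambda_max (outer u u - U - (q - p) *\<^sub>R mat 1) < 0 \<and> \<bar>w\<bar> < c \<and>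
     (\<exists>\<tau>. 0 < \<tau> \<and> \<tau> < 1 \<and>
        W $ 1 < u $ 1 * w
          + \<tau> * min ((u $ 1 - f1 (-1) p q u U) * (c - w)) ((f1 1 p q u U - u $ 1) * (w + c)) \<and>
        W $ 1 > u $ 1 * w
          - \<tau> * min ((u $ 1 - f1 (-1) p q u U) * (w + c)) ((f1 1 p q u U - u $ 1) * (c - w)) \<and>
        W $ 2 < u $ 2 * w
          + (1 - \<tau>) * min ((u $ 2 - f2 (-1) p q u U) * (c - w)) ((f2 1 p q u U - u $ 2) * (w + c)) \<and>
        W $ 2 > u $ 2 * w
          - (1 - \<tau>) * min ((u $ 2 - f2 (-1) p q u U) * (w + c)) ((f2 1 p q u U - u $ 2) * (c - w)))}"

end

theory Submission
  imports Defs
begin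

text \<open>
  Put \<open>M = (q - p) I + U\<close>. A state lies in the constitutive set iff \<open>M = u \<otimes> u\<close>, \<open>W = w u\<close> and
  \<open>\<bar>w\<bar> = c\<close>; the eigenvalue condition defining the set on the left says that \<open>M - u \<otimes> u\<close> is positive
  definite, i.e. that \<open>u\<close> lies inside the ellipse \<open>{v. v \<otimes> v \<le> M}\<close>. The wave cone is large: two states
  may be joined as soon as they have the same \<open>U\<close>, or as soon as they have the same \<open>w\<close> and both
  satisfy \<open>W = w u\<close>. With these two kinds of segments every state of the explicit set is built from
  the constitutive set in four steps.

  \<^enum> If \<open>M - u \<otimes> u = n \<otimes> n\<close> has rank at most one, then \<open>(u, w, U, w u)\<close> with \<open>\<bar>w\<bar> = c\<close> lies on a segment
    between two constitutive states with velocities \<open>u + t n\<close> and \<open>u + s n\<close>, where \<open>s t = -1\<close>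
    (\<open>rank_one_defect_mem\<close>).

  \<^enum> The numbers \<open>f1\<^sup>\<plusminus>\<close> are the first coordinates of the two points in which the horizontal line through
    \<open>u\<close> meets the boundary of the ellipse, where the first step applies. Joining these two points gives
    all states with velocity on the horizontal chord, the same \<open>U\<close>, and \<open>W = w u\<close>, \<open>\<bar>w\<bar> = c\<close>;
    \<open>f2\<^sup>\<plusminus>\<close> do the same for the vertical chord (\<open>horizontal_chord_mem\<close>, \<open>vertical_chord_mem\<close>).

  \<^enum> Joining a state with \<open>w = c\<close> and velocity \<open>u + d / (c + w)\<close> to a state with \<open>w = -c\<close> and velocity
    \<open>u - d / (c - w)\<close>, with the same \<open>U\<close>, yields \<open>(u, w, U, w u + d)\<close> (\<open>shifted_flux_mem\<close>). For \<open>d\<close>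
    horizontal, requiring both velocities to lie strictly inside the chord is the pair of conditions on
    \<open>W\<close> with factor \<open>\<tau> = 1\<close>; likewise for \<open>d\<close> vertical and \<open>\<tau> = 0\<close>.

  \<^enum> A horizontal shift \<open>d1\<close> and a vertical shift \<open>d2\<close> are averaged with weights \<open>\<tau>\<close> and \<open>1 - \<tau>\<close>,
    which is where the factors \<open>\<tau>\<close> and \<open>1 - \<tau>\<close> come from (\<open>strict_subsolution_mem\<close>).

  All the defining inequalities are strict and continuous in the state, so they persist on a relative
  neighbourhood, and the state is interior to the hull.
\<close>

section \<open>Directions in the wave cone\<close>

lemma vec2_eq_iff: "(x :: 'a^2) = y \<longleftrightarrow> x $ 1 = y $ 1 \<and> x $ 2 = y $ 2"
  by (simp add: vec_eq_iff forall_2)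

lemma mem_Sym0_iff: "U \<in> Sym0 \<longleftrightarrow> U $ 2 $ 1 = U $ 1 $ 2 \<and> U $ 2 $ 2 = - U $ 1 $ 1"
  by (auto simp: Sym0_def trace_def transpose_def vec2_eq_iff sum_2)

lemma wave_coneI:
  assumes "U \<in> Sym0" "a \<noteq> 0 \<or> b \<noteq> 0 \<or> d \<noteq> 0"
    and "u $ 1 * a + u $ 2 * b + w * d = 0"
    and "\<eta>t *\<^sub>R u + U *v vector [a, b] + d *\<^sub>R W = 0"
  shows "(u, w, U, W) \<in> wave_cone"
proof -
  define \<eta>x :: "real^3" where "\<eta>x = vector [a, b, d]"
  have "\<eta>x \<noteq> 0"
    using assms(2) by (auto simp: \<eta>x_def vec_eq_iff forall_3)
  moreover have "wave_matrix (u, w, U, W) *v vector [\<eta>t, \<eta>x $ 1, \<eta>x $ 2, \<eta>x $ 3] = 0"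
    using assms(3,4)
    by (simp add: wave_matrix_def \<eta>x_def matrix_vector_mult_def vec_eq_iff forall_2 forall_3
        sum_2 sum_4 vector_def algebra_simps)
  ultimately show ?thesis
    using assms(1) unfolding wave_cone_def state_space_def by blast
qed

text \<open>
  A difference with no change of \<open>w\<close> whose flux is a multiple of its velocity is annihilated by the
  space-time direction \<open>(-k, 0, 0, 1)\<close>; this joins states with equal \<open>w\<close> and \<open>W = w u\<close>.
\<close>

lemma wave_cone_advected:
  assumes "U \<in> Sym0"
  shows "(u, 0, U, k *\<^sub>R u) \<in> wave_cone"
  by (rule wave_coneI[where a = 0 and b = 0 and d = 1 and \<eta>t = "-k"])
    (use assms in \<open>auto simp: vec2_eq_iff matrix_vector_mult_def sum_2\<close>)

text \<open>
  If \<open>U\<close> does not change, a plane wave varying, within the plane of the first two space coordinates, in the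
  direction orthogonal to \<open>u\<close> (in any direction if \<open>u = 0\<close>) is compatible with an arbitrary jump of \<open>w\<close> and \<open>W\<close>.
\<close>

lemma wave_cone_constant_stress: "(u, w, 0, W) \<in> wave_cone"
proof (cases "u = 0")
  case True
  then show ?thesis
    by (intro wave_coneI[where a = 1 and b = 0 and d = 0 and \<eta>t = 0])
      (auto simp: mem_Sym0_iff)
next
  case False
  then show ?thesis
    by (intro wave_coneI[where a = "-u $ 2" and b = "u $ 1" and d = 0 and \<eta>t = 0])
      (auto simp: mem_Sym0_iff vec2_eq_iff)
qed

lemma wave_cone_convexD:
  assumes "wave_cone_convex S" "x \<in> S" "y \<in> S" "x - y \<in> wave_cone" "0 \<le> a" "a \<le> 1"
  shows "(1 - a) *\<^sub>R x + a *\<^sub>R y \<in> S"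
  using assms unfolding wave_cone_convex_def closed_segment_def by blast

section \<open>States with a defect of rank at most one\<close>

lemma rank_one_decomposition:
  fixes a b h :: real
  assumes "0 \<le> a" "0 \<le> b" "a * b = h\<^sup>2"
  obtains n1 n2 where "n1\<^sup>2 = a" "n2\<^sup>2 = b" "n1 * n2 = h"
proof
  have "sqrt a * sqrt b = \<bar>h\<bar>"
    using assms by (metis real_sqrt_abs real_sqrt_mult)
  then show "sqrt a * ((if h < 0 then -1 else 1) * sqrt b) = h"
    by auto
qed (use assms in \<open>auto simp: power_mult_distrib\<close>)

text \<open>The norm condition is what makes \<open>u \<otimes> u - (q - p) I\<close> trace-free.\<close>

lemma constitutive_setI:
  assumes "(u $ 1)\<^sup>2 + (u $ 2)\<^sup>2 = 2 * (q - p)" "\<bar>w\<bar> = c"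
  shows "(u, w, outer u u - (q - p) *\<^sub>R mat 1, w *\<^sub>R u) \<in> constitutive_set p q c"
  using assms by (auto simp: constitutive_set_def mem_Sym0_iff outer_def mat_def vec2_eq_iff
      power2_eq_square algebra_simps)

text \<open>
  Write the defect \<open>M - u \<otimes> u\<close> as \<open>n \<otimes> n\<close>. Its trace is \<open>\<bar>n\<bar>\<^sup>2 = 2 (q - p) - \<bar>u\<bar>\<^sup>2\<close>, so the line \<open>u + x n\<close>
  meets the circle of admissible velocities, of squared radius \<open>2 (q - p)\<close>, where
  \<open>x\<^sup>2 + 2 m x = 1\<close> with \<open>m = u \<bullet> n / \<bar>n\<bar>\<^sup>2\<close>. The roots \<open>s > 0 > t\<close> have product \<open>-1\<close>, hence the two-point
  law on \<open>{t, s}\<close> with mean \<open>0\<close> has variance \<open>- s t = 1\<close>: averaging \<open>v \<otimes> v\<close> over the two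
  velocities returns exactly \<open>u \<otimes> u + n \<otimes> n = M\<close>.
\<close>

lemma rank_one_defect_mem:
  assumes S: "wave_cone_convex S" "constitutive_set p q c \<subseteq> S"
    and U: "U \<in> Sym0" and w: "\<bar>w\<bar> = c"
    and N: "q - p + U $ 1 $ 1 - (u $ 1)\<^sup>2 \<ge> 0" "q - p - U $ 1 $ 1 - (u $ 2)\<^sup>2 \<ge> 0"
      "(q - p + U $ 1 $ 1 - (u $ 1)\<^sup>2) * (q - p - U $ 1 $ 1 - (u $ 2)\<^sup>2)
         = (U $ 1 $ 2 - u $ 1 * u $ 2)\<^sup>2"
  shows "(u, w, U, w *\<^sub>R u) \<in> S"
proof -
  obtain n1 n2 where n: "n1\<^sup>2 = q - p + U $ 1 $ 1 - (u $ 1)\<^sup>2"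
    "n2\<^sup>2 = q - p - U $ 1 $ 1 - (u $ 2)\<^sup>2" "n1 * n2 = U $ 1 $ 2 - u $ 1 * u $ 2"
    using rank_one_decomposition[OF N] by metis
  define n :: "real^2" where "n = vector [n1, n2]"
  define k where "k = n1\<^sup>2 + n2\<^sup>2"
  have k: "k = 2 * (q - p) - (u $ 1)\<^sup>2 - (u $ 2)\<^sup>2"
    by (simp add: k_def n)
  \<comment> \<open>If \<open>n = 0\<close>, any value of \<open>m\<close> would do: both roots then give the velocity \<open>u\<close> itself.\<close>
  define m where "m = (if k = 0 then 0 else (n1 * u $ 1 + n2 * u $ 2) / k)"
  have mk: "n1 * u $ 1 + n2 * u $ 2 = m * k"
    by (auto simp: m_def k_def sum_power2_eq_zero_iff)
  define s where "s = - m + sqrt (m\<^sup>2 + 1)"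
  define t where "t = - m - sqrt (m\<^sup>2 + 1)"
  have sq: "(sqrt (m\<^sup>2 + 1))\<^sup>2 = m\<^sup>2 + 1"
    by simp
  have st: "s * t = -1"
    using sq by (simp add: s_def t_def algebra_simps power2_eq_square)
  have roots: "x\<^sup>2 + 2 * m * x = 1" if "x = s \<or> x = t" for x
  proof -
    have "x + m = sqrt (m\<^sup>2 + 1) \<or> x + m = - sqrt (m\<^sup>2 + 1)"
      using that by (auto simp: s_def t_def)
    then have "(x + m)\<^sup>2 = m\<^sup>2 + 1"
      using sq by auto
    then show ?thesis
      by (simp add: power2_eq_square algebra_simps)
  qed
  have "sqrt (m\<^sup>2 + 1) > 0"
    by (simp add: add_nonneg_pos)
  then have "s > t"
    by (simp add: s_def t_def)
  then have sg: "s > 0" "t < 0"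
    using st by (smt (verit) mult_nonneg_nonneg mult_nonpos_nonpos)+
  define \<alpha> where "\<alpha> = - t / (s - t)"
  have \<alpha>: "0 \<le> \<alpha>" "\<alpha> \<le> 1"
    using sg by (auto simp: \<alpha>_def divide_simps)
  have mean: "(1 - \<alpha>) * t + \<alpha> * s = 0"
    using sg by (simp add: \<alpha>_def field_simps)
  have variance: "(1 - \<alpha>) * t\<^sup>2 + \<alpha> * s\<^sup>2 = 1"
  proof -
    have "(1 - \<alpha>) * t\<^sup>2 + \<alpha> * s\<^sup>2 = (s + t) * ((1 - \<alpha>) * t + \<alpha> * s) - s * t"
      by (simp add: algebra_simps power2_eq_square)
    then show ?thesis using mean st by simp
  qed
  define P where "P x = (let v = u + x *\<^sub>R n in
      (v, w, outer v v - (q - p) *\<^sub>R mat 1, w *\<^sub>R v))" for x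
  have PK: "P x \<in> constitutive_set p q c" if "x = s \<or> x = t" for x
  proof -
    have "(u $ 1 + x * n1)\<^sup>2 + (u $ 2 + x * n2)\<^sup>2
        = (u $ 1)\<^sup>2 + (u $ 2)\<^sup>2 + 2 * x * (n1 * u $ 1 + n2 * u $ 2) + x\<^sup>2 * k"
      by (simp add: k_def power2_eq_square algebra_simps)
    also have "\<dots> = (u $ 1)\<^sup>2 + (u $ 2)\<^sup>2 + (x\<^sup>2 + 2 * m * x) * k"
      by (simp add: mk algebra_simps)
    also have "\<dots> = 2 * (q - p)"
      using roots[OF that] k by simp
    finally show ?thesis
      unfolding P_def Let_def using w by (intro constitutive_setI) (auto simp: n_def)
  qed
  have sub: "outer (u + t *\<^sub>R n) (u + t *\<^sub>R n) - outer (u + s *\<^sub>R n) (u + s *\<^sub>R n) \<in> Sym0"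
  proof -
    have "P s \<in> constitutive_set p q c" "P t \<in> constitutive_set p q c"
      using PK by auto
    then show ?thesis
      by (auto simp: P_def Let_def constitutive_set_def mem_Sym0_iff mat_def)
  qed
  have "P t - P s \<in> wave_cone"
    using wave_cone_advected[OF sub, of "(t - s) *\<^sub>R n" w]
    by (simp add: P_def Let_def algebra_simps)
  then have "(1 - \<alpha>) *\<^sub>R P t + \<alpha> *\<^sub>R P s \<in> S"
    using S PK \<alpha> by (intro wave_cone_convexD) auto
  moreover have "(1 - \<alpha>) *\<^sub>R P t + \<alpha> *\<^sub>R P s = (u, w, U, w *\<^sub>R u)"
  proof -
    have lin: "(1 - \<alpha>) * (x + t * y) + \<alpha> * (x + s * y) = x" for x y
    proof -
      have "(1 - \<alpha>) * (x + t * y) + \<alpha> * (x + s * y) = x + ((1 - \<alpha>) * t + \<alpha> * s) * y"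
        by (simp add: algebra_simps)
      then show ?thesis by (simp add: mean)
    qed
    have quad: "(1 - \<alpha>) * ((x + t * y) * (x' + t * y') - z) + \<alpha> * ((x + s * y) * (x' + s * y') - z)
        = x * x' + y * y' - z" for x y x' y' z
    proof -
      have "(1 - \<alpha>) * ((x + t * y) * (x' + t * y') - z) + \<alpha> * ((x + s * y) * (x' + s * y') - z)
         = x * x' + ((1 - \<alpha>) * t + \<alpha> * s) * (x * y' + x' * y)
          + ((1 - \<alpha>) * t\<^sup>2 + \<alpha> * s\<^sup>2) * (y * y') - z"
        by (simp add: algebra_simps power2_eq_square)
      then show ?thesis by (simp add: mean variance)
    qed
    have "(1 - \<alpha>) *\<^sub>R (u + t *\<^sub>R n) + \<alpha> *\<^sub>R (u + s *\<^sub>R n) = u"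
      by (simp add: vec2_eq_iff lin)
    moreover from this have "(1 - \<alpha>) *\<^sub>R w *\<^sub>R (u + t *\<^sub>R n) + \<alpha> *\<^sub>R w *\<^sub>R (u + s *\<^sub>R n) = w *\<^sub>R u"
      by (metis scaleR_left_commute scaleR_right_distrib)
    moreover have "(1 - \<alpha>) *\<^sub>R (outer (u + t *\<^sub>R n) (u + t *\<^sub>R n) - (q - p) *\<^sub>R mat 1)
        + \<alpha> *\<^sub>R (outer (u + s *\<^sub>R n) (u + s *\<^sub>R n) - (q - p) *\<^sub>R mat 1) = U"
      using U n
      by (simp add: vec2_eq_iff outer_def mat_def quad quad[where z = 0, simplified] n_def mem_Sym0_iff)
        (simp add: power2_eq_square mult.commute)
    ultimately show ?thesis
      by (simp add: P_def Let_def algebra_simps)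
  qed
  ultimately show ?thesis by simp
qed

section \<open>Chords of the ellipse of subsolution velocities\<close>

lemma det_pressure_stress:
  assumes "U \<in> Sym0"
  shows "det (r *\<^sub>R mat 1 + U) = (r + U $ 1 $ 1) * (r - U $ 1 $ 1) - (U $ 1 $ 2)\<^sup>2"
  using assms by (simp add: det_2 mem_Sym0_iff mat_def power2_eq_square)

lemma velocity_segment_mem:
  assumes S: "wave_cone_convex S"
    and "(x, w, U, w *\<^sub>R x) \<in> S" "(y, w, U, w *\<^sub>R y) \<in> S" "v \<in> closed_segment x y"
  shows "(v, w, U, w *\<^sub>R v) \<in> S"
proof -
  obtain a where a: "0 \<le> a" "a \<le> 1" "v = (1 - a) *\<^sub>R x + a *\<^sub>R y"
    using assms(4) by (auto simp: closed_segment_def)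
  have "(1 - a) *\<^sub>R (x, w, U, w *\<^sub>R x) + a *\<^sub>R (y, w, U, w *\<^sub>R y) \<in> S"
    using assms a by (intro wave_cone_convexD) (auto intro: wave_cone_constant_stress)
  moreover have "(1 - a) *\<^sub>R (x, w, U, w *\<^sub>R x) + a *\<^sub>R (y, w, U, w *\<^sub>R y) = (v, w, U, w *\<^sub>R v)"
    by (simp add: a algebra_simps)
  ultimately show ?thesis by simp
qed

text \<open>
  For \<open>M\<close> with diagonal entries \<open>A\<close>, \<open>B\<close> and off-diagonal entry \<open>C\<close>, the determinant of
  \<open>M - (x, y) \<otimes> (x, y)\<close> is a quadratic polynomial in \<open>x\<close>, and \<open>f1\<^sup>\<plusminus>\<close> is the quadratic formula for its
  roots. Exchanging the coordinates gives \<open>f2\<^sup>\<plusminus>\<close>.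
\<close>

lemma ellipse_root:
  fixes A B C y s :: real
  defines "D \<equiv> A * B - C\<^sup>2"
  defines "x \<equiv> (y * C + s * sqrt ((B - y\<^sup>2) * D)) / B"
  assumes "0 < B" "0 \<le> (B - y\<^sup>2) * D" "s\<^sup>2 = 1"
  shows "(A - x\<^sup>2) * (B - y\<^sup>2) = (C - x * y)\<^sup>2"
proof -
  have "(B * x - y * C)\<^sup>2 = (B - y\<^sup>2) * D"
    using assms by (simp add: power_mult_distrib)
  then have "B * ((A - x\<^sup>2) * (B - y\<^sup>2) - (C - x * y)\<^sup>2) = 0"
    unfolding D_def by (simp add: power2_eq_square algebra_simps)
  then show ?thesis using assms(3) by simp
qed

text \<open>
  Adding the positive semidefinite matrix \<open>(x, y) \<otimes> (x, y)\<close> to a positive definite one does not decrease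
  the determinant; so the radicands in \<open>f1\<^sup>\<plusminus>\<close> and \<open>f2\<^sup>\<plusminus>\<close> are positive.
\<close>

lemma posdef_stress:
  fixes a b h x y :: real
  assumes "0 < a - x\<^sup>2" "(h - x * y)\<^sup>2 < (a - x\<^sup>2) * (b - y\<^sup>2)"
  shows "h\<^sup>2 < a * b"
proof -
  define A B H where "A = a - x\<^sup>2" and "B = b - y\<^sup>2" and "H = h - x * y"
  have "0 \<le> (A * y - H * x)\<^sup>2 + (A * B - H\<^sup>2) * x\<^sup>2"
    using assms(2) by (simp add: A_def B_def H_def)
  also have "\<dots> = A * ((a * b - h\<^sup>2) - (A * B - H\<^sup>2))"
    by (simp add: A_def B_def H_def power2_eq_square algebra_simps)
  finally have "A * B - H\<^sup>2 \<le> a * b - h\<^sup>2"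
    using assms(1) by (simp add: A_def zero_le_mult_iff)
  then show ?thesis
    using assms(2) by (simp add: A_def B_def H_def)
qed

text \<open>
  At the endpoints of the chord the defect is singular, and since one of its diagonal entries is
  unchanged and positive, it is positive semidefinite of rank one. So the endpoints are available,
  and the points between them follow because \<open>U\<close> is constant along the chord.
\<close>

lemma horizontal_chord_mem:
  assumes S: "wave_cone_convex S" "constitutive_set p q c \<subseteq> S"
    and U: "U \<in> Sym0" and w: "\<bar>w\<bar> = c"
    and N: "q - p - U $ 1 $ 1 - (u $ 2)\<^sup>2 > 0" "det ((q - p) *\<^sub>R mat 1 + U) > 0"
    and v: "f1 (-1) p q u U \<le> v $ 1" "v $ 1 \<le> f1 1 p q u U" "v $ 2 = u $ 2"
  shows "(v, w, U, w *\<^sub>R v) \<in> S"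
proof -
  define e where "e s = (vector [f1 s p q u U, u $ 2] :: real^2)" for s
  have "q - p - U $ 1 $ 1 > 0"
    using N(1) by (smt (verit) zero_le_power2)
  then have E: "(q - p + U $ 1 $ 1 - (e s $ 1)\<^sup>2) * (q - p - U $ 1 $ 1 - (e s $ 2)\<^sup>2)
         = (U $ 1 $ 2 - e s $ 1 * e s $ 2)\<^sup>2" if "s\<^sup>2 = 1" for s
    using ellipse_root[of "q - p - U $ 1 $ 1" "u $ 2" "q - p + U $ 1 $ 1" "U $ 1 $ 2" s] N that U
    by (simp add: e_def f1_def det_pressure_stress)
  have mem: "(e s, w, U, w *\<^sub>R e s) \<in> S" if "s\<^sup>2 = 1" for s
  proof (rule rank_one_defect_mem[OF S U w _ _ E[OF that]])
    show "q - p - U $ 1 $ 1 - (e s $ 2)\<^sup>2 \<ge> 0"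
      using N by (simp add: e_def)
    have "(q - p + U $ 1 $ 1 - (e s $ 1)\<^sup>2) * (q - p - U $ 1 $ 1 - (e s $ 2)\<^sup>2) \<ge> 0"
      unfolding E[OF that] by simp
    then show "q - p + U $ 1 $ 1 - (e s $ 1)\<^sup>2 \<ge> 0"
      using N(1) by (simp add: e_def zero_le_mult_iff)
  qed
  have "v $ 1 \<in> closed_segment (f1 (-1) p q u U) (f1 1 p q u U)"
    using v by (simp add: closed_segment_eq_real_ivl)
  then have "v \<in> closed_segment (e (-1)) (e 1)"
    using v(3) by (auto simp: closed_segment_def e_def vec2_eq_iff algebra_simps)
  then show ?thesis
    by (rule velocity_segment_mem[OF S(1) mem mem, rotated 2]) auto
qed

lemma vertical_chord_mem:
  assumes S: "wave_cone_convex S" "constitutive_set p q c \<subseteq> S"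
    and U: "U \<in> Sym0" and w: "\<bar>w\<bar> = c"
    and N: "q - p + U $ 1 $ 1 - (u $ 1)\<^sup>2 > 0" "det ((q - p) *\<^sub>R mat 1 + U) > 0"
    and v: "f2 (-1) p q u U \<le> v $ 2" "v $ 2 \<le> f2 1 p q u U" "v $ 1 = u $ 1"
  shows "(v, w, U, w *\<^sub>R v) \<in> S"
proof -
  define e where "e s = (vector [u $ 1, f2 s p q u U] :: real^2)" for s
  have "q - p + U $ 1 $ 1 > 0"
    using N(1) by (smt (verit) zero_le_power2)
  then have E: "(q - p + U $ 1 $ 1 - (e s $ 1)\<^sup>2) * (q - p - U $ 1 $ 1 - (e s $ 2)\<^sup>2)
         = (U $ 1 $ 2 - e s $ 1 * e s $ 2)\<^sup>2" if "s\<^sup>2 = 1" for s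
    using ellipse_root[of "q - p + U $ 1 $ 1" "u $ 1" "q - p - U $ 1 $ 1" "U $ 1 $ 2" s] N that U
    by (simp add: e_def f2_def det_pressure_stress mult.commute)
  have mem: "(e s, w, U, w *\<^sub>R e s) \<in> S" if "s\<^sup>2 = 1" for s
  proof (rule rank_one_defect_mem[OF S U w _ _ E[OF that]])
    show "q - p + U $ 1 $ 1 - (e s $ 1)\<^sup>2 \<ge> 0"
      using N by (simp add: e_def)
    have "(q - p + U $ 1 $ 1 - (e s $ 1)\<^sup>2) * (q - p - U $ 1 $ 1 - (e s $ 2)\<^sup>2) \<ge> 0"
      unfolding E[OF that] by simp
    then show "q - p - U $ 1 $ 1 - (e s $ 2)\<^sup>2 \<ge> 0"
      using N(1) by (simp add: e_def zero_le_mult_iff)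
  qed
  have "v $ 2 \<in> closed_segment (f2 (-1) p q u U) (f2 1 p q u U)"
    using v by (simp add: closed_segment_eq_real_ivl)
  then have "v \<in> closed_segment (e (-1)) (e 1)"
    using v(3) by (auto simp: closed_segment_def e_def vec2_eq_iff algebra_simps)
  then show ?thesis
    by (rule velocity_segment_mem[OF S(1) mem mem, rotated 2]) auto
qed

section \<open>Producing a flux that differs from \<open>w u\<close>\<close>

text \<open>
  The weights \<open>(c + w) / 2c\<close> and \<open>(c - w) / 2c\<close> are dictated by the average of \<open>c\<close> and \<open>- c\<close> being \<open>w\<close>. The
  two velocity shifts cancel in the average of \<open>u\<close>, but add up in the average of \<open>W = \<plusminus>c u\<close>, and the
  factors \<open>1 / (c \<plusminus> w)\<close> normalise their sum to \<open>d\<close>.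
\<close>

lemma shifted_flux_mem:
  assumes S: "wave_cone_convex S" and w: "\<bar>w\<bar> < c"
    and "(u + (1 / (c + w)) *\<^sub>R d, c, U, c *\<^sub>R (u + (1 / (c + w)) *\<^sub>R d)) \<in> S" (is "?P \<in> S")
    and "(u - (1 / (c - w)) *\<^sub>R d, - c, U, (- c) *\<^sub>R (u - (1 / (c - w)) *\<^sub>R d)) \<in> S" (is "?Q \<in> S")
  shows "(u, w, U, w *\<^sub>R u + d) \<in> S"
proof -
  define a where "a = (c + w) / (2 * c)"
  have c: "c > 0" "c + w \<noteq> 0" "c - w \<noteq> 0"
    using w by auto
  have a: "0 \<le> a" "a \<le> 1"
    using w by (auto simp: a_def)
  have a': "1 - a = (c - w) / (2 * c)"
    using c by (simp add: a_def field_simps)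
  have "(1 - a) *\<^sub>R ?Q + a *\<^sub>R ?P \<in> S"
    using S assms(3,4) a by (intro wave_cone_convexD) (auto intro: wave_cone_constant_stress)
  moreover have "(1 - a) *\<^sub>R ?Q + a *\<^sub>R ?P = (u, w, U, w *\<^sub>R u + d)"
  proof -
    have *: "(1 - a) *\<^sub>R (u - (1 / (c - w)) *\<^sub>R d) + a *\<^sub>R (u + (1 / (c + w)) *\<^sub>R d) = u"
      unfolding a' a_def using c by (simp add: vec2_eq_iff divide_simps) (simp add: algebra_simps)
    have **: "(1 - a) *\<^sub>R (- c) *\<^sub>R (u - (1 / (c - w)) *\<^sub>R d)
        + a *\<^sub>R c *\<^sub>R (u + (1 / (c + w)) *\<^sub>R d) = w *\<^sub>R u + d"
      unfolding a' a_def using c by (simp add: vec2_eq_iff divide_simps) (simp add: algebra_simps)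
    have "(1 - a) * (- c) + a * c = w"
      unfolding a' a_def using c by (simp add: field_simps)
    moreover have "(1 - a) *\<^sub>R U + a *\<^sub>R U = U"
      by (simp flip: scaleR_add_left)
    ultimately show ?thesis
      using * ** by simp
  qed
  ultimately show ?thesis by simp
qed

text \<open>
  Positive definiteness of \<open>M - u \<otimes> u\<close> is expressed through its entries, which depend continuously on the
  state and make sense also for \<open>U\<close> outside the symmetric trace-free matrices. So the set is
  open in the ambient space.
\<close>

definition strict_subsolutions :: "real \<Rightarrow> real \<Rightarrow> real \<Rightarrow> state set" where
  "strict_subsolutions p q c = {(u, w, U, W).
     q - p + U $ 1 $ 1 - (u $ 1)\<^sup>2 > 0 \<and> q - p - U $ 1 $ 1 - (u $ 2)\<^sup>2 > 0 \<and>
     (U $ 1 $ 2 - u $ 1 * u $ 2)\<^sup>2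
       < (q - p + U $ 1 $ 1 - (u $ 1)\<^sup>2) * (q - p - U $ 1 $ 1 - (u $ 2)\<^sup>2) \<and> \<bar>w\<bar> < c}"

definition flux_bounds :: "real \<Rightarrow> real \<Rightarrow> real \<Rightarrow> real \<Rightarrow> state set" where
  "flux_bounds p q c \<tau> = {(u, w, U, W).
        W $ 1 < u $ 1 * w
          + \<tau> * min ((u $ 1 - f1 (-1) p q u U) * (c - w)) ((f1 1 p q u U - u $ 1) * (w + c)) \<and>
        W $ 1 > u $ 1 * w
          - \<tau> * min ((u $ 1 - f1 (-1) p q u U) * (w + c)) ((f1 1 p q u U - u $ 1) * (c - w)) \<and>
        W $ 2 < u $ 2 * w
          + (1 - \<tau>) * min ((u $ 2 - f2 (-1) p q u U) * (c - w)) ((f2 1 p q u U - u $ 2) * (w + c)) \<and>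
        W $ 2 > u $ 2 * w
          - (1 - \<tau>) * min ((u $ 2 - f2 (-1) p q u U) * (w + c)) ((f2 1 p q u U - u $ 2) * (c - w))}"

text \<open>
  The bounds on the flux are equivalent to keeping both velocities of the previous construction
  on the chord from \<open>l\<close> to \<open>m\<close>, up to strictness.
\<close>

lemma shift_bounds:
  fixes c w x l m d :: real
  assumes "\<bar>w\<bar> < c" "d < min ((x - l) * (c - w)) ((m - x) * (w + c))"
    "- min ((x - l) * (w + c)) ((m - x) * (c - w)) < d"
  shows "l \<le> x + d / (c + w)" "x + d / (c + w) \<le> m" "l \<le> x - d / (c - w)" "x - d / (c - w) \<le> m"
proof -
  have "c + w > 0" "c - w > 0" using assms(1) by auto
  moreover have "d < (x - l) * (c - w)" "d < (m - x) * (c + w)"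
    "- d < (x - l) * (c + w)" "- d < (m - x) * (c - w)"
    using assms(2,3) by (auto simp: add.commute)
  ultimately show "l \<le> x + d / (c + w)" "x + d / (c + w) \<le> m"
    "l \<le> x - d / (c - w)" "x - d / (c - w) \<le> m"
    by (auto simp: field_simps)
qed

lemma strict_subsolution_mem:
  assumes S: "wave_cone_convex S" "constitutive_set p q c \<subseteq> S"
    and z: "z \<in> state_space" "z \<in> strict_subsolutions p q c" "z \<in> flux_bounds p q c \<tau>"
    and \<tau>: "0 < \<tau>" "\<tau> < 1"
  shows "z \<in> S"
proof -
  obtain u w U W where zeq: "z = (u, w, U, W)" by (cases z)
  have U: "U \<in> Sym0" using z(1) by (simp add: state_space_def zeq)
  have w: "\<bar>w\<bar> < c" and N: "q - p + U $ 1 $ 1 - (u $ 1)\<^sup>2 > 0" "q - p - U $ 1 $ 1 - (u $ 2)\<^sup>2 > 0"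
    and detN: "(U $ 1 $ 2 - u $ 1 * u $ 2)\<^sup>2
       < (q - p + U $ 1 $ 1 - (u $ 1)\<^sup>2) * (q - p - U $ 1 $ 1 - (u $ 2)\<^sup>2)"
    using z(2) by (auto simp: strict_subsolutions_def zeq)
  have detM: "det ((q - p) *\<^sub>R mat 1 + U) > 0"
    using posdef_stress[OF N(1) detN] by (simp add: det_pressure_stress[OF U])
  have c: "\<bar>c\<bar> = c" "\<bar>- c\<bar> = c" using w by auto
  \<comment> \<open>The flux defect \<open>W - w u\<close> is \<open>\<tau> D1 + (1 - \<tau>) D2\<close> with \<open>D1\<close> horizontal and \<open>D2\<close> vertical.\<close>
  define d1 where "d1 = (W $ 1 - u $ 1 * w) / \<tau>"
  define d2 where "d2 = (W $ 2 - u $ 2 * w) / (1 - \<tau>)"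
  define D1 :: "real^2" where "D1 = vector [d1, 0]"
  define D2 :: "real^2" where "D2 = vector [0, d2]"
  have b1: "d1 < min ((u $ 1 - f1 (-1) p q u U) * (c - w)) ((f1 1 p q u U - u $ 1) * (w + c))"
    "- min ((u $ 1 - f1 (-1) p q u U) * (w + c)) ((f1 1 p q u U - u $ 1) * (c - w)) < d1"
    and b2: "d2 < min ((u $ 2 - f2 (-1) p q u U) * (c - w)) ((f2 1 p q u U - u $ 2) * (w + c))"
    "- min ((u $ 2 - f2 (-1) p q u U) * (w + c)) ((f2 1 p q u U - u $ 2) * (c - w)) < d2"
    using z(3) \<tau> unfolding flux_bounds_def zeq d1_def d2_def
    by (simp_all add: pos_divide_less_eq pos_less_divide_eq mult.commute del: min_less_iff_conj)
  have m1: "(u, w, U, w *\<^sub>R u + D1) \<in> S"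
    by (intro shifted_flux_mem[OF S(1) w] horizontal_chord_mem[OF S U _ N(2) detM])
      (use c shift_bounds[OF w b1] in \<open>auto simp: D1_def\<close>)
  have m2: "(u, w, U, w *\<^sub>R u + D2) \<in> S"
    by (intro shifted_flux_mem[OF S(1) w] vertical_chord_mem[OF S U _ N(1) detM])
      (use c shift_bounds[OF w b2] in \<open>auto simp: D2_def\<close>)
  have "(1 - \<tau>) *\<^sub>R (u, w, U, w *\<^sub>R u + D2) + \<tau> *\<^sub>R (u, w, U, w *\<^sub>R u + D1) \<in> S"
    using S(1) m1 m2 \<tau> by (intro wave_cone_convexD) (auto intro: wave_cone_constant_stress)
  moreover have "(1 - \<tau>) *\<^sub>R (u, w, U, w *\<^sub>R u + D2) + \<tau> *\<^sub>R (u, w, U, w *\<^sub>R u + D1) = z"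
  proof -
    have "(1 - \<tau>) * d2 = W $ 2 - u $ 2 * w" "\<tau> * d1 = W $ 1 - u $ 1 * w"
      using \<tau> by (simp_all add: d1_def d2_def)
    then have avg: "(1 - \<tau>) *\<^sub>R D2 + \<tau> *\<^sub>R D1 = W - w *\<^sub>R u"
      by (simp add: vec2_eq_iff D1_def D2_def mult.commute)
    have "(1 - \<tau>) *\<^sub>R (w *\<^sub>R u + D2) + \<tau> *\<^sub>R (w *\<^sub>R u + D1)
        = w *\<^sub>R u + ((1 - \<tau>) *\<^sub>R D2 + \<tau> *\<^sub>R D1)"
      by (simp add: vec2_eq_iff algebra_simps)
    then have "(1 - \<tau>) *\<^sub>R (w *\<^sub>R u + D2) + \<tau> *\<^sub>R (w *\<^sub>R u + D1) = W"
      using avg by simp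
    moreover have "(1 - \<tau>) *\<^sub>R u + \<tau> *\<^sub>R u = u" "(1 - \<tau>) *\<^sub>R U + \<tau> *\<^sub>R U = U" "(1 - \<tau>) * w + \<tau> * w = w"
      by (simp_all flip: scaleR_add_left distrib_right)
    ultimately show ?thesis
      by (simp add: zeq)
  qed
  ultimately show ?thesis by simp
qed

section \<open>Negative definiteness from the largest eigenvalue\<close>

lemma mem_eigenvalues_iff_det: "l \<in> eigenvalues A \<longleftrightarrow> det (A - l *\<^sub>R mat 1) = 0"
  for A :: "real^'n^'n"
proof -
  have "(A - l *\<^sub>R mat 1) *v v = 0 \<longleftrightarrow> A *v v = l *\<^sub>R v" for v
    by (simp add: matrix_vector_mult_diff_rdistrib flip: scaleR_matrix_vector_assoc)
  then have "l \<in> eigenvalues A \<longleftrightarrow> (\<exists>v. v \<noteq> 0 \<and> (A - l *\<^sub>R mat 1) *v v = 0)"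
    by (simp add: eigenvalues_def)
  then show ?thesis
    using matrix_left_invertible_ker[of "A - l *\<^sub>R mat 1"] invertible_det_nz[of "A - l *\<^sub>R mat 1"]
      invertible_left_inverse[of "A - l *\<^sub>R mat 1"] by blast
qed

text \<open>
  The set of eigenvalues has to be computed explicitly, since \<open>Max\<close> is informative only for a finite
  nonempty set. Symmetry makes the discriminant \<open>(a - b)\<^sup>2 + 4 h\<^sup>2\<close> nonnegative, and the larger root being
  negative amounts to \<open>a + b < 0\<close> and \<open>a b > h\<^sup>2\<close>.
\<close>

lemma lambda_max_sym2_neg:
  fixes A :: "real^2^2"
  assumes sym: "A $ 2 $ 1 = A $ 1 $ 2" and neg: "lambda_max A < 0"
  shows "A $ 1 $ 1 < 0" "A $ 2 $ 2 < 0" "(A $ 1 $ 2)\<^sup>2 < A $ 1 $ 1 * A $ 2 $ 2"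
proof -
  define a b h where "a = A $ 1 $ 1" and "b = A $ 2 $ 2" and "h = A $ 1 $ 2"
  define R where "R = sqrt ((a - b)\<^sup>2 + 4 * h\<^sup>2)"
  have R: "R\<^sup>2 = (a - b)\<^sup>2 + 4 * h\<^sup>2" "R \<ge> 0"
    by (simp_all add: R_def)
  have char: "l \<in> eigenvalues A \<longleftrightarrow> l = (a + b + R) / 2 \<or> l = (a + b - R) / 2" for l
  proof -
    have "4 * ((l - (a + b + R) / 2) * (l - (a + b - R) / 2)) = (2 * l - (a + b))\<^sup>2 - R\<^sup>2"
      by (simp add: power2_eq_square field_simps)
    also have "\<dots> = 4 * ((a - l) * (b - l) - h\<^sup>2)"
      unfolding R(1) by (simp add: power2_eq_square algebra_simps)
    finally have factor: "4 * ((l - (a + b + R) / 2) * (l - (a + b - R) / 2)) = \<dots>" .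
    have "l \<in> eigenvalues A \<longleftrightarrow> (a - l) * (b - l) - h\<^sup>2 = 0"
      using sym by (simp add: mem_eigenvalues_iff_det det_2 mat_def a_def b_def h_def power2_eq_square)
    also have "\<dots> \<longleftrightarrow> 4 * ((l - (a + b + R) / 2) * (l - (a + b - R) / 2)) = 0"
      unfolding factor by simp
    finally show ?thesis by simp
  qed
  have "eigenvalues A = {(a + b + R) / 2, (a + b - R) / 2}"
    using char by blast
  then have "a + b + R < 0"
    using neg by (simp add: lambda_max_def)
  then have "R < - (a + b)" by simp
  then have "R\<^sup>2 < (- (a + b))\<^sup>2"
    using R(2) by (intro power_strict_mono) auto
  have ab: "h\<^sup>2 < a * b"
  proof -
    have "4 * (a * b - h\<^sup>2) = (- (a + b))\<^sup>2 - R\<^sup>2"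
      unfolding R(1) by (simp add: power2_eq_square algebra_simps)
    also have "\<dots> > 0"
      using \<open>R\<^sup>2 < (- (a + b))\<^sup>2\<close> by (simp only: diff_gt_0_iff_gt)
    finally show ?thesis by simp
  qed
  then have "0 < a * b" by (smt (verit) zero_le_power2)
  then show "A $ 1 $ 1 < 0" "A $ 2 $ 2 < 0" "(A $ 1 $ 2)\<^sup>2 < A $ 1 $ 1 * A $ 2 $ 2"
    using \<open>a + b + R < 0\<close> R(2) ab by (auto simp: a_def b_def h_def zero_less_mult_iff)
qed

section \<open>Openness\<close>

lemma open_Collect_less_on:
  fixes f g :: "'a::topological_space \<Rightarrow> real"
  assumes "open P" "continuous_on P f" "continuous_on P g"
  shows "open {x \<in> P. f x < g x}"
proof -
  have "open ((\<lambda>x. g x - f x) -` {0<..} \<inter> P)"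
    using assms(1) continuous_on_diff[OF assms(3,2)] by (simp add: continuous_on_open_vimage)
  also have "(\<lambda>x. g x - f x) -` {0<..} \<inter> P = {x \<in> P. f x < g x}"
    by auto
  finally show ?thesis .
qed

lemma open_strict_subsolutions: "open (strict_subsolutions p q c)"
  unfolding strict_subsolutions_def case_prod_unfold
  by (intro open_Collect_conj open_Collect_less continuous_intros)

text \<open>
  The functions \<open>f1\<close> and \<open>f2\<close> are continuous only away from the zeros of their denominators, hence the
  intersection with the strict subsolutions.
\<close>

lemma open_flux_bounds: "open (strict_subsolutions p q c \<inter> flux_bounds p q c \<tau>)"
proof -
  have nz: "q - p - U $ 1 $ 1 \<noteq> 0" "q - p + U $ 1 $ 1 \<noteq> 0"
    if "(u, w, U, W) \<in> strict_subsolutions p q c" for u w U W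
  proof -
    have "(u $ 2)\<^sup>2 < q - p - U $ 1 $ 1" "(u $ 1)\<^sup>2 < q - p + U $ 1 $ 1"
      using that by (auto simp: strict_subsolutions_def)
    then show "q - p - U $ 1 $ 1 \<noteq> 0" "q - p + U $ 1 $ 1 \<noteq> 0"
      by (auto simp: not_less)
  qed
  have f: "continuous_on (strict_subsolutions p q c) (\<lambda>z. f1 s p q (fst z) (fst (snd (snd z))))"
     "continuous_on (strict_subsolutions p q c) (\<lambda>z. f2 s p q (fst z) (fst (snd (snd z))))" for s
    unfolding f1_def f2_def det_2 by (intro continuous_intros ballI; force dest: nz)+
  let ?u = "\<lambda>i z :: state. fst z $ i" and ?w = "\<lambda>z :: state. fst (snd z)"
    and ?W = "\<lambda>i z :: state. snd (snd (snd z)) $ i"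
    and ?f = "\<lambda>s z :: state. f1 s p q (fst z) (fst (snd (snd z)))"
    and ?g = "\<lambda>s z :: state. f2 s p q (fst z) (fst (snd (snd z)))"
    and ?P = "strict_subsolutions p q c"
  have "?P \<inter> flux_bounds p q c \<tau> =
      {z \<in> ?P. ?W 1 z < ?u 1 z * ?w z + \<tau> * min ((?u 1 z - ?f (-1) z) * (c - ?w z)) ((?f 1 z - ?u 1 z) * (?w z + c))}
    \<inter> {z \<in> ?P. ?u 1 z * ?w z - \<tau> * min ((?u 1 z - ?f (-1) z) * (?w z + c)) ((?f 1 z - ?u 1 z) * (c - ?w z)) < ?W 1 z}
    \<inter> {z \<in> ?P. ?W 2 z < ?u 2 z * ?w z + (1 - \<tau>) * min ((?u 2 z - ?g (-1) z) * (c - ?w z)) ((?g 1 z - ?u 2 z) * (?w z + c))}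
    \<inter> {z \<in> ?P. ?u 2 z * ?w z - (1 - \<tau>) * min ((?u 2 z - ?g (-1) z) * (?w z + c)) ((?g 1 z - ?u 2 z) * (c - ?w z)) < ?W 2 z}"
    by (simp only: flux_bounds_def case_prod_unfold set_eq_iff Int_iff mem_Collect_eq)
      (intro allI iffI conjI; elim conjE; assumption)
  also have "open \<dots>"
    by (intro open_Int open_Collect_less_on open_strict_subsolutions continuous_intros f)
  finally show ?thesis .
qed

section \<open>The explicit set lies in the interior of the hull\<close>

theorem corollary6p8:
  fixes p q c :: real
  shows "W_set p q c \<subseteq> U_set p q c"
proof
  fix z assume z: "z \<in> W_set p q c"
  then obtain \<tau> where \<tau>: "0 < \<tau>" "\<tau> < 1" and flux: "z \<in> flux_bounds p q c \<tau>"
    unfolding W_set_def flux_bounds_def by auto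
  have space: "z \<in> state_space"
    using z by (auto simp: W_set_def state_space_def)
  have strict: "z \<in> strict_subsolutions p q c"
  proof -
    obtain u w U W where zeq: "z = (u, w, U, W)" by (cases z)
    have U: "U $ 2 $ 1 = U $ 1 $ 2" "U $ 2 $ 2 = - U $ 1 $ 1"
      and neg: "lambda_max (outer u u - U - (q - p) *\<^sub>R mat 1) < 0" and w: "\<bar>w\<bar> < c"
      using z by (auto simp: W_set_def zeq mem_Sym0_iff)
    show ?thesis
      using lambda_max_sym2_neg[OF _ neg] U w
      by (simp add: zeq strict_subsolutions_def outer_def mat_def power2_eq_square algebra_simps)
  qed
  let ?O = "strict_subsolutions p q c \<inter> flux_bounds p q c \<tau>"
  \<comment> \<open>The hull is the intersection of all convex supersets, and each of them contains the neighbourhood.\<close>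
  have "state_space \<inter> ?O \<subseteq> wave_cone_convex hull (constitutive_set p q c)"
    unfolding hull_def using strict_subsolution_mem[OF _ _ _ _ _ \<tau>] by blast
  moreover have "openin (top_of_set state_space) (state_space \<inter> ?O)"
    by (intro openin_open_Int open_flux_bounds)
  ultimately show "z \<in> U_set p q c"
    unfolding U_set_def using interior_of_maximal space strict flux by blast
qed

end
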